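(* Let $G=(V,E)$ be a connected graph with order $n \geq 3$, and let $\mathcal{M}(G)$ be its Mycielskian with root vertex $u^*$. Then there is a general position set $S$ of $\mathcal{M}(G)$ with $|S| \geq n+1$ and $u^*\in S$ if and only if $G$ is a complete graph $K_n$ or $G$ is the join of $K_1$ with a disjoint union of cliques, at least one of which is $K_1$.
   Context: All graphs are simple, connected and finite. A set $S$ of vertices of a graph $H$ is a general position set if no shortest path (geodesic) in $H$ contains three or more vertices of $S$. The Mycielskian $\mathcal{M}(G)$ of a graph $G$ with vertex set $V$ and edge set $E$ has vertex set $V\cup V'\cup\{u^*\}$, where $V'=\{u' : u\in V\}$ is a disjoint copy of $V$ and $u^*$ is an additional vertex (the root), and edge set $E\cup\{uv' : uv\in E\}\cup\{v'u^* : v'\in V'\}$ (here for each edge $uv\in E$ both $uv'$ and $vu'$ are included). *)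

theory Defs
  imports "Graph_Theory.Graph_Theory" "HOL-Library.Disjoint_Sets"
begin

text \<open>
  A finite simple graph is a \<^locale>\<open>pair_graph\<close>: every edge \<open>uv\<close> is represented by the two
  arcs \<open>(u, v)\<close> and \<open>(v, u)\<close>.
\<close>

definition geodesic :: "'a pair_pre_digraph \<Rightarrow> 'a \<Rightarrow> ('a \<times> 'a) awalk \<Rightarrow> 'a \<Rightarrow> bool" where
  "geodesic G u p v \<longleftrightarrow>
     pre_digraph.apath (with_proj G) u p v \<and>
     (\<forall>q. pre_digraph.apath (with_proj G) u q v \<longrightarrow> length p \<le> length q)"

definition general_position :: "'a pair_pre_digraph \<Rightarrow> 'a set \<Rightarrow> bool" where
  "general_position G S \<longleftrightarrow>
     S \<subseteq> pverts G \<and>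
     \<not> (\<exists>u p v. geodesic G u p v \<and> card (set (pawalk_verts u p) \<inter> S) \<ge> 3)"

datatype 'a myc_vertex = Orig 'a | Copy 'a | Root

definition mycielskian :: "'a pair_pre_digraph \<Rightarrow> 'a myc_vertex pair_pre_digraph" where
  "mycielskian G =
     \<lparr> pverts = Orig ` pverts G \<union> Copy ` pverts G \<union> {Root},
       parcs = {(Orig u, Orig v) | u v. (u, v) \<in> parcs G}
             \<union> {(Orig u, Copy v) | u v. (u, v) \<in> parcs G}
             \<union> {(Copy u, Orig v) | u v. (u, v) \<in> parcs G}
             \<union> {(Copy v, Root) | v. v \<in> pverts G}
             \<union> {(Root, Copy v) | v. v \<in> pverts G} \<rparr>"

lemma pair_graph_mycielskian:
  assumes "pair_graph G"
  shows "pair_graph (mycielskian G)"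
proof -
  interpret pair_graph G by fact
  have V: "finite (pverts (mycielskian G))"
    by (simp add: mycielskian_def)
  have A: "parcs (mycielskian G) \<subseteq> pverts (mycielskian G) \<times> pverts (mycielskian G)"
    by (auto simp: mycielskian_def dest: in_arcsD1 in_arcsD2)
  have "symmetric (with_proj (mycielskian G))"
    using pair_sym_arcs
    by (auto simp: mycielskian_def symmetric_def intro!: symI dest: symD)
  moreover have "fst e \<noteq> snd e" if "e \<in> parcs (mycielskian G)" for e
    using that by (auto simp: mycielskian_def dest: no_loops')
  ultimately show ?thesis
    using A V finite_subset[OF A finite_cartesian_product[OF V V]]
    by unfold_locales auto
qed

text \<open>
  Disjoint unions and joins are internal: the constituents are graphs on pairwise disjoint
  sets of vertices of the same type.
\<close>

definition is_disjoint_union :: "'a pair_pre_digraph \<Rightarrow> 'a pair_pre_digraph set \<Rightarrow> bool" where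
  "is_disjoint_union G Hs \<longleftrightarrow>
     disjoint_family_on pverts Hs \<and>
     G = \<lparr> pverts = (\<Union>H\<in>Hs. pverts H), parcs = (\<Union>H\<in>Hs. parcs H) \<rparr>"

definition is_join :: "'a pair_pre_digraph \<Rightarrow> 'a pair_pre_digraph \<Rightarrow> 'a pair_pre_digraph \<Rightarrow> bool" where
  "is_join G H K \<longleftrightarrow>
     pverts H \<inter> pverts K = {} \<and>
     G = \<lparr> pverts = pverts H \<union> pverts K,
           parcs = parcs H \<union> parcs K \<union> pverts H \<times> pverts K \<union> pverts K \<times> pverts H \<rparr>"

end

theory Submission
  imports Defs
begin

text \<open>
  Two vertices \<open>u'\<close>, \<open>v'\<close> of the copy are at distance two through the root, so a general position
  set \<open>S\<close> containing the root meets the copy in at most one vertex. To reach \<open>n + 1\<close> elements it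
  must therefore contain all original vertices, or all but one original vertex \<open>x\<close> together with
  a single copy \<open>y'\<close>. On the original vertices in \<open>S\<close> there is no induced path with two edges
  (\<open>general_position_adjacent_closed\<close>): adjacency is transitive there, and the graph they induce is
  a disjoint union of cliques. In the first case connectedness makes \<open>G\<close> complete.

  In the second case a neighbour \<open>u \<noteq> x\<close> of \<open>y\<close> would give the geodesic \<open>u, y', u\<^sup>*\<close> inside \<open>S\<close>;
  hence \<open>y\<close> is a leaf attached to \<open>x\<close>, an isolated vertex of \<open>G - x\<close>. If \<open>x\<close> were not adjacent to
  all other vertices, connectedness would give an edge \<open>ab\<close> with \<open>a\<close> adjacent to \<open>x\<close> and \<open>b\<close> not.
  Then \<open>y', x, a, b\<close> is a geodesic with three vertices in \<open>S\<close>
  (\<open>general_position_three_step_shortcut\<close>). So \<open>G\<close> is the cone with apex \<open>x\<close> over a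
  disjoint union of cliques, one of which is \<open>{y}\<close>.

  Conversely, a complete graph and such a cone have diameter at most two, and then so does the
  Mycielskian. A geodesic there has at most three vertices, so it is enough to see that no three
  vertices of the sets above form an induced path (\<open>general_position_diameter_two\<close>).
\<close>

section \<open>Geodesics on at most four vertices\<close>

lemma apath_with_proj_iff:
  "pre_digraph.apath (with_proj G) u p v \<longleftrightarrow>
     u \<in> pverts G \<and> set p \<subseteq> parcs G \<and> pcas u p v \<and> distinct (pawalk_verts u p)"
  by (simp add: pre_digraph.apath_def pre_digraph.awalk_def cas_with_proj_eq
      awalk_verts_with_proj_eq)

lemma apath_length_0_1:
  assumes "pre_digraph.apath (with_proj G) u p v" and "length p < 2"
  shows "u = v \<or> (u, v) \<in> parcs G"
  using assms by (cases p) (auto simp: apath_with_proj_iff)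

lemma apath_length_2:
  assumes "pre_digraph.apath (with_proj G) u p v" and "length p = 2"
  obtains m where "p = [(u, m), (m, v)]" and "(u, m) \<in> parcs G" and "(m, v) \<in> parcs G"
    and "distinct [u, m, v]"
  using assms by (fastforce simp: apath_with_proj_iff length_Suc_conv numeral_2_eq_2)

text \<open>
  Without the arc \<open>ac\<close>, the path \<open>a, b, c\<close> would itself be a geodesic.
\<close>

lemma general_position_adjacent_closed:
  assumes "general_position G S" and "a \<in> S" and "b \<in> S" and "c \<in> S"
    and "(a, b) \<in> parcs G" and "(b, c) \<in> parcs G" and "distinct [a, b, c]"
  shows "(a, c) \<in> parcs G"
proof (rule ccontr)
  assume "(a, c) \<notin> parcs G"
  let ?p = "[(a, b), (b, c)]"
  have "geodesic G a ?p c"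
    unfolding geodesic_def
  proof (intro conjI allI impI)
    show "pre_digraph.apath (with_proj G) a ?p c"
      using assms by (auto simp: apath_with_proj_iff general_position_def)
  next
    fix q assume "pre_digraph.apath (with_proj G) a q c"
    then have "\<not> length q < 2"
      using apath_length_0_1[of G a q c] \<open>(a, c) \<notin> parcs G\<close> assms(7) by auto
    then show "length ?p \<le> length q" by simp
  qed
  moreover have "set (pawalk_verts a ?p) \<inter> S = {a, b, c}"
    using assms by auto
  ultimately show False
    using assms(1,7) unfolding general_position_def by fastforce
qed

text \<open>
  The vertex \<open>x\<close> may lie outside the set: a path of three edges that contains only three elements
  of \<open>S\<close> already violates general position when it is a geodesic, that is, when its ends are
  at distance at least three.
\<close>

lemma general_position_three_step_shortcut:
  assumes "general_position G S" and "a \<in> S" and "b \<in> S" and "c \<in> S"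
    and "(a, x) \<in> parcs G" and "(x, b) \<in> parcs G" and "(b, c) \<in> parcs G"
    and "distinct [a, x, b, c]"
  shows "(a, c) \<in> parcs G \<or> (\<exists>m. (a, m) \<in> parcs G \<and> (m, c) \<in> parcs G)"
proof (rule ccontr)
  assume far: "\<not> ?thesis"
  let ?p = "[(a, x), (x, b), (b, c)]"
  have "geodesic G a ?p c"
    unfolding geodesic_def
  proof (intro conjI allI impI)
    show "pre_digraph.apath (with_proj G) a ?p c"
      using assms by (auto simp: apath_with_proj_iff general_position_def)
  next
    fix q assume q: "pre_digraph.apath (with_proj G) a q c"
    have "\<not> length q < 2"
      using apath_length_0_1[OF q] far assms(8) by auto
    moreover have "length q \<noteq> 2"
      using apath_length_2[OF q] far by metis
    ultimately show "length ?p \<le> length q" by simp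
  qed
  moreover have "{a, b, c} \<subseteq> set (pawalk_verts a ?p) \<inter> S"
    using assms by auto
  then have "card {a, b, c} \<le> card (set (pawalk_verts a ?p) \<inter> S)"
    by (intro card_mono) auto
  ultimately show False
    using assms(1,8) unfolding general_position_def by fastforce
qed

text \<open>
  Under \<open>diam\<close>, a geodesic has at most two edges. If it contains three elements of \<open>S\<close>, it
  consists of exactly these three vertices and its ends are not adjacent, which \<open>closed\<close> excludes.
\<close>

lemma general_position_diameter_two:
  assumes G: "pair_graph G" and S: "S \<subseteq> pverts G"
    and diam: "\<And>u v. \<lbrakk>u \<in> pverts G; v \<in> pverts G; u \<noteq> v; (u, v) \<notin> parcs G\<rbrakk>
                 \<Longrightarrow> \<exists>m. (u, m) \<in> parcs G \<and> (m, v) \<in> parcs G"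
    and closed: "\<And>a b c. \<lbrakk>a \<in> S; b \<in> S; c \<in> S; (a, b) \<in> parcs G; (b, c) \<in> parcs G; a \<noteq> c\<rbrakk>
                 \<Longrightarrow> (a, c) \<in> parcs G"
  shows "general_position G S"
  unfolding general_position_def
proof (intro conjI notI S)
  interpret pair_graph G by fact
  assume "\<exists>u p v. geodesic G u p v \<and> 3 \<le> card (set (pawalk_verts u p) \<inter> S)"
  then obtain u p v where geo: "geodesic G u p v"
    and three: "3 \<le> card (set (pawalk_verts u p) \<inter> S)" by blast
  have ap: "pre_digraph.apath (with_proj G) u p v"
    and min: "\<And>q. pre_digraph.apath (with_proj G) u q v \<Longrightarrow> length p \<le> length q"
    using geo by (auto simp: geodesic_def)
  have uv: "u \<in> pverts G" "v \<in> pverts G"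
    using ap by (auto intro: awalk_last_in_verts dest: awalkI_apath)
  have adj: "length p \<le> 1" if "u = v \<or> (u, v) \<in> parcs G"
  proof (cases "u = v")
    case True
    then show ?thesis using min[of "[]"] uv by (simp add: apath_with_proj_iff)
  next
    case False
    then show ?thesis using min[of "[(u, v)]"] that uv by (simp add: apath_with_proj_iff)
  qed
  have le2: "length p \<le> 2"
  proof (cases "u = v \<or> (u, v) \<in> parcs G")
    case False
    then obtain m where "(u, m) \<in> parcs G" "(m, v) \<in> parcs G"
      using diam uv by blast
    then show ?thesis
      using min[of "[(u, m), (m, v)]"] uv False no_loops'
      by (auto simp: apath_with_proj_iff)
  qed (use adj in simp)
  have len: "length (pawalk_verts u p) = Suc (length p)"
    by (induction p arbitrary: u) auto
  have "card (set (pawalk_verts u p) \<inter> S) \<le> card (set (pawalk_verts u p))"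
    by (intro card_mono) auto
  also have "\<dots> \<le> Suc (length p)"
    using card_length[of "pawalk_verts u p"] len by simp
  finally have "length p = 2"
    using three le2 by simp
  then obtain m where p: "p = [(u, m), (m, v)]" "(u, m) \<in> parcs G" "(m, v) \<in> parcs G"
    and d: "distinct [u, m, v]"
    using apath_length_2[OF ap] by blast
  have "{u, m, v} \<inter> S = {u, m, v}"
    by (rule card_seteq) (use three d p in auto)
  then show False
    using closed[of u m v] p d adj \<open>length p = 2\<close> by auto
qed

section \<open>Connected graphs and cliques\<close>

text \<open>
  This is the form in which connectedness is used: a set containing one vertex and closed under
  taking neighbours contains all of them.
\<close>

lemma connected_closed_set_eq_verts:
  assumes G: "pair_graph G" and conn: "Digraph_Component.connected (with_proj G)"
    and x: "x \<in> A" "x \<in> pverts G"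
    and step: "\<And>a b. \<lbrakk>a \<in> A; (a, b) \<in> parcs G\<rbrakk> \<Longrightarrow> b \<in> A"
  shows "pverts G \<subseteq> A"
proof
  interpret pair_graph G by fact
  fix v assume v: "v \<in> pverts G"
  have "strongly_connected (with_proj G)"
    using symmetric_connected_imp_strongly_connected pair_sym_arcs conn by blast
  then have "x \<rightarrow>\<^sup>*\<^bsub>with_proj G\<^esub> v"
    using x v by (auto simp: strongly_connected_def)
  then show "v \<in> A"
    by (induction rule: reachable_induct) (use x step in auto)
qed

text \<open>
  Under \<open>tr\<close> the closed neighbourhood of any vertex is closed under taking neighbours.
\<close>

lemma connected_adjacent_closed_imp_complete:
  assumes G: "pair_graph G" and conn: "Digraph_Component.connected (with_proj G)"
    and tr: "\<And>a b c. \<lbrakk>(a, b) \<in> parcs G; (b, c) \<in> parcs G; a \<noteq> c\<rbrakk> \<Longrightarrow> (a, c) \<in> parcs G"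
  shows "complete_digraph (card (pverts G)) (with_proj G)"
proof -
  interpret pair_graph G by fact
  have "(u, v) \<in> parcs G" if "u \<in> pverts G" "v \<in> pverts G" "u \<noteq> v" for u v
  proof -
    have "pverts G \<subseteq> insert u {w. (u, w) \<in> parcs G}"
      by (rule connected_closed_set_eq_verts[OF G conn, of u]) (use that tr in auto)
    then show ?thesis using that by blast
  qed
  then show ?thesis
    unfolding complete_digraph_pair_def
    by (auto dest: in_arcsD1 in_arcsD2 no_loops')
qed

lemma connected_ex_neighbour:
  assumes G: "pair_graph G" and conn: "Digraph_Component.connected (with_proj G)"
    and "card (pverts G) \<ge> 2" and u: "u \<in> pverts G"
  shows "\<exists>v. (u, v) \<in> parcs G"
proof (rule ccontr)
  assume "\<nexists>v. (u, v) \<in> parcs G"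
  then have "pverts G \<subseteq> {u}"
    by (intro connected_closed_set_eq_verts[OF G conn, of u]) (use u in auto)
  then have "card (pverts G) \<le> 1"
    using card_mono[of "{u}"] by simp
  then show False using assms(3) by simp
qed

section \<open>Cones over disjoint unions of cliques\<close>

text \<open>
  The join of \<open>{x}\<close> with a disjoint union of cliques, one of them \<open>{y}\<close>, described by arcs alone.
  The last clause says that \<open>G - x\<close> is a disjoint union of cliques: adjacency or equality
  is an equivalence relation on its vertices.
\<close>

definition pendant_clique_cone :: "'a pair_pre_digraph \<Rightarrow> 'a \<Rightarrow> 'a \<Rightarrow> bool" where
  "pendant_clique_cone G x y \<longleftrightarrow>
     x \<in> pverts G \<and> y \<in> pverts G - {x} \<and>
     (\<forall>v\<in>pverts G - {x}. (x, v) \<in> parcs G) \<and>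
     (\<forall>v. (y, v) \<in> parcs G \<longrightarrow> v = x) \<and>
     (\<forall>a b c. a \<noteq> x \<and> b \<noteq> x \<and> c \<noteq> x \<and> a \<noteq> c \<and> (a, b) \<in> parcs G \<and> (b, c) \<in> parcs G
        \<longrightarrow> (a, c) \<in> parcs G)"

lemma pendant_clique_cone_of_join:
  assumes K: "complete_digraph 1 (with_proj K)" and J: "is_join G K H"
    and U: "is_disjoint_union H Cs"
    and cl: "\<forall>C\<in>Cs. \<exists>m\<ge>1. complete_digraph m (with_proj C)"
    and C1: "\<exists>C\<in>Cs. complete_digraph 1 (with_proj C)"
  shows "\<exists>x y. pendant_clique_cone G x y"
proof -
  obtain x where Kx: "pverts K = {x}" "parcs K = {}"
    using K by (auto simp: complete_digraph_pair_def card_Suc_eq)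
  obtain C0 y where C0: "C0 \<in> Cs" "pverts C0 = {y}"
    using C1 by (auto simp: complete_digraph_pair_def card_Suc_eq)
  have clique: "parcs C = {(u, v). (u, v) \<in> pverts C \<times> pverts C \<and> u \<noteq> v}" if "C \<in> Cs" for C
    using cl that by (auto simp: complete_digraph_pair_def)
  have same: "C = D" if "C \<in> Cs" "D \<in> Cs" "v \<in> pverts C" "v \<in> pverts D" for C D v
    using U that by (auto simp: is_disjoint_union_def disjoint_family_on_def)
  have H: "pverts H = (\<Union>C\<in>Cs. pverts C)"
    "(a, b) \<in> parcs H \<longleftrightarrow> (\<exists>C\<in>Cs. a \<in> pverts C \<and> b \<in> pverts C \<and> a \<noteq> b)" for a b
    using U clique by (auto simp: is_disjoint_union_def)
  have xH: "x \<notin> pverts H"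
    using J Kx by (auto simp: is_join_def)
  have G_eq: "pverts G = insert x (pverts H)"
    "parcs G = parcs H \<union> {x} \<times> pverts H \<union> pverts H \<times> {x}"
    using J Kx by (auto simp: is_join_def)
  have HH: "a \<in> pverts H" "b \<in> pverts H" if "(a, b) \<in> parcs H" for a b
    using that H by auto
  have "pendant_clique_cone G x y"
    unfolding pendant_clique_cone_def
  proof (intro conjI ballI allI impI)
    show "x \<in> pverts G" "y \<in> pverts G - {x}"
      using G_eq xH C0 H(1) by auto
    show "(x, v) \<in> parcs G" if "v \<in> pverts G - {x}" for v
      using that G_eq by auto
    show "v = x" if yv: "(y, v) \<in> parcs G" for v
    proof (rule ccontr)
      assume "v \<noteq> x"
      then obtain C where "C \<in> Cs" "y \<in> pverts C" "v \<in> pverts C" "y \<noteq> v"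
        using yv xH C0 H G_eq by auto
      then show False using same[of C C0 y] C0 by auto
    qed
    show "(a, c) \<in> parcs G"
      if h: "a \<noteq> x \<and> b \<noteq> x \<and> c \<noteq> x \<and> a \<noteq> c \<and> (a, b) \<in> parcs G \<and> (b, c) \<in> parcs G" for a b c
    proof -
      have "(a, b) \<in> parcs H" "(b, c) \<in> parcs H"
        using h G_eq by auto
      then obtain C D where "C \<in> Cs" "a \<in> pverts C" "b \<in> pverts C"
        "D \<in> Cs" "b \<in> pverts D" "c \<in> pverts D"
        using H by auto
      then have "(a, c) \<in> parcs H"
        using h same[of C D b] H(2) by blast
      then show ?thesis using G_eq by simp
    qed
  qed
  then show ?thesis by blast
qed

text \<open>
  The constituents of the disjoint union are the closed neighbourhoods in \<open>G - x\<close>, that is, the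
  classes of the equivalence relation ``equal or adjacent''.
\<close>

lemma join_of_pendant_clique_cone:
  assumes G: "pair_graph G" and cone: "pendant_clique_cone G x y"
  shows "\<exists>K H Cs. complete_digraph 1 (with_proj K) \<and>
       is_join G K H \<and> is_disjoint_union H Cs \<and>
       (\<forall>C\<in>Cs. \<exists>m\<ge>1. complete_digraph m (with_proj C)) \<and>
       (\<exists>C\<in>Cs. complete_digraph 1 (with_proj C))"
proof -
  interpret pair_graph G by fact
  have sym: "(b, a) \<in> parcs G" if "(a, b) \<in> parcs G" for a b
    using that arcs_symmetric by blast
  have x: "x \<in> pverts G" and y: "y \<in> pverts G - {x}"
    and univ: "\<And>v. v \<in> pverts G - {x} \<Longrightarrow> (x, v) \<in> parcs G"
    and leaf: "\<And>v. (y, v) \<in> parcs G \<Longrightarrow> v = x"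
    and tr: "\<And>a b c. \<lbrakk>a \<noteq> x; b \<noteq> x; c \<noteq> x; a \<noteq> c; (a, b) \<in> parcs G; (b, c) \<in> parcs G\<rbrakk>
               \<Longrightarrow> (a, c) \<in> parcs G"
    using cone unfolding pendant_clique_cone_def by blast+
  define W where "W = pverts G - {x}"
  define N where "N u = {w \<in> W. w = u \<or> (u, w) \<in> parcs G}" for u
  define clique where
    "clique A = \<lparr>pverts = A, parcs = {(a, b). (a, b) \<in> A \<times> A \<and> a \<noteq> b}\<rparr>" for A :: "'a set"
  define K where "K = clique {x}"
  define H where "H = \<lparr>pverts = W, parcs = parcs G \<inter> W \<times> W\<rparr>"
  define Cs where "Cs = clique ` N ` W"
  have N_adj: "(a, b) \<in> parcs G" if "u \<in> W" "a \<in> N u" "b \<in> N u" "a \<noteq> b" for u a b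
    using that tr[of a u b] sym[of u a] by (auto simp: N_def W_def)
  \<comment> \<open>Classes that share a vertex coincide, so that distinct cliques are disjoint.\<close>
  have N_eq: "N u = N v" if "u \<in> W" "v \<in> W" "w \<in> N u" "w \<in> N v" for u v w
  proof -
    have sub: "N u \<subseteq> N v" if "u \<in> W" "v \<in> W" "w \<in> N u" "w \<in> N v" for u v w
    proof
      fix a assume a: "a \<in> N u"
      show "a \<in> N v"
      proof (cases "a = w \<or> w = v")
        case True
        then show ?thesis using that a N_adj[of u w a] by (auto simp: N_def)
      next
        case False
        then have "(v, w) \<in> parcs G" "(w, a) \<in> parcs G"
          using that a N_adj[of u w a] by (auto simp: N_def)
        then show ?thesis
          using that a tr[of v w a] by (auto simp: N_def W_def)
      qed
    qed
    show ?thesis using sub[of u v w] sub[of v u w] that by blast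
  qed
  have complete: "complete_digraph (card A) (with_proj (clique A))" if "finite A" for A
    using that by (simp add: complete_digraph_pair_def clique_def)
  have finN: "finite (N u)" for u
    by (simp add: N_def W_def)
  have "complete_digraph 1 (with_proj K)"
    using complete[of "{x}"] by (simp add: K_def)
  moreover have "is_join G K H"
  proof -
    have spokes: "(v, x) \<in> parcs G \<and> (x, v) \<in> parcs G" if "v \<in> W" for v
      using univ sym that unfolding W_def by blast
    have "parcs G = parcs H \<union> {x} \<times> W \<union> W \<times> {x}"
    proof (intro equalityI subrelI)
      fix a b assume ab: "(a, b) \<in> parcs G"
      then have "a \<noteq> b" "a \<in> insert x W" "b \<in> insert x W"
        using no_loops' in_arcsD1 in_arcsD2 unfolding W_def by blast+
      then show "(a, b) \<in> parcs H \<union> {x} \<times> W \<union> W \<times> {x}"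
        using ab by (auto simp: H_def)
    next
      fix a b assume "(a, b) \<in> parcs H \<union> {x} \<times> W \<union> W \<times> {x}"
      then show "(a, b) \<in> parcs G"
        using spokes[of a] spokes[of b] by (auto simp: H_def)
    qed
    moreover have "parcs K = {}" "pverts K = {x}" "pverts H = W"
      by (auto simp: K_def clique_def H_def)
    moreover have "pverts G = insert x W" "x \<notin> W"
      using x by (auto simp: W_def)
    ultimately show ?thesis
      unfolding is_join_def by (simp add: pair_pre_digraph.equality)
  qed
  moreover have "is_disjoint_union H Cs"
    unfolding is_disjoint_union_def
  proof
    show "disjoint_family_on pverts Cs"
      unfolding disjoint_family_on_def
    proof (intro ballI impI)
      fix C D assume "C \<in> Cs" "D \<in> Cs" "C \<noteq> D"
      then obtain u v where uv: "u \<in> W" "v \<in> W" "C = clique (N u)" "D = clique (N v)"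
        by (auto simp: Cs_def)
      then show "pverts C \<inter> pverts D = {}"
        using N_eq[OF uv(1,2)] \<open>C \<noteq> D\<close> by (auto simp: clique_def)
    qed
    have "W = (\<Union>C\<in>Cs. pverts C)"
      by (auto simp: Cs_def clique_def N_def)
    moreover have "parcs G \<inter> W \<times> W = (\<Union>C\<in>Cs. parcs C)"
    proof (intro equalityI subsetI)
      fix e assume "e \<in> parcs G \<inter> W \<times> W"
      then obtain a b where "e = (a, b)" "(a, b) \<in> parcs G" "a \<in> W" "b \<in> W" by auto
      then have "e \<in> parcs (clique (N a))"
        using no_loops'[of a b] by (auto simp: clique_def N_def)
      then show "e \<in> (\<Union>C\<in>Cs. parcs C)"
        using \<open>a \<in> W\<close> by (auto simp: Cs_def)
    next
      fix e assume "e \<in> (\<Union>C\<in>Cs. parcs C)"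
      then obtain u a b where "u \<in> W" "e = (a, b)" "a \<in> N u" "b \<in> N u" "a \<noteq> b"
        by (auto simp: Cs_def clique_def)
      then show "e \<in> parcs G \<inter> W \<times> W"
        using N_adj[of u a b] by (auto simp: N_def)
    qed
    ultimately show "H = \<lparr>pverts = \<Union> (pverts ` Cs), parcs = \<Union> (parcs ` Cs)\<rparr>"
      by (simp add: H_def)
  qed
  moreover have "\<exists>m\<ge>1. complete_digraph m (with_proj C)" if C: "C \<in> Cs" for C
  proof -
    obtain u where u: "u \<in> W" "C = clique (N u)"
      using C by (auto simp: Cs_def)
    then have "u \<in> N u" by (simp add: N_def)
    then have "card (N u) \<ge> 1"
      using finN[of u] by (metis One_nat_def Suc_leI card_gt_0_iff empty_iff)
    then show ?thesis using complete[OF finN] u by blast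
  qed
  moreover have "\<exists>C\<in>Cs. complete_digraph 1 (with_proj C)"
  proof
    have "N y = {y}"
      using y leaf by (auto simp: N_def W_def)
    then show "complete_digraph 1 (with_proj (clique (N y)))"
      using complete[of "{y}"] by simp
    show "clique (N y) \<in> Cs"
      using y by (simp add: Cs_def W_def)
  qed
  ultimately show ?thesis by blast
qed

section \<open>The Mycielskian\<close>

lemma pverts_mycielskian [simp]:
  "pverts (mycielskian G) = Orig ` pverts G \<union> Copy ` pverts G \<union> {Root}"
  by (simp add: mycielskian_def)

lemma parcs_mycielskian_iff [simp]:
  "(Orig u, Orig v) \<in> parcs (mycielskian G) \<longleftrightarrow> (u, v) \<in> parcs G"
  "(Orig u, Copy v) \<in> parcs (mycielskian G) \<longleftrightarrow> (u, v) \<in> parcs G"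
  "(Copy u, Orig v) \<in> parcs (mycielskian G) \<longleftrightarrow> (u, v) \<in> parcs G"
  "(Copy u, Copy v) \<notin> parcs (mycielskian G)"
  "(Copy v, Root) \<in> parcs (mycielskian G) \<longleftrightarrow> v \<in> pverts G"
  "(Root, Copy v) \<in> parcs (mycielskian G) \<longleftrightarrow> v \<in> pverts G"
  "(Orig v, Root) \<notin> parcs (mycielskian G)"
  "(Root, Orig v) \<notin> parcs (mycielskian G)"
  "(Root, Root) \<notin> parcs (mycielskian G)"
  by (auto simp: mycielskian_def)

text \<open>
  A walk \<open>u, m, v\<close> of \<open>G\<close> lifts to the Mycielskian for every choice of original or copy at its ends,
  always with the original of \<open>m\<close> in the middle; this includes \<open>u = v\<close>, where \<open>nbr\<close> provides \<open>m\<close>.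
  Two copies also meet at the root, and an original is joined to the root through the copy of
  any of its neighbours.
\<close>

lemma mycielskian_diameter_two:
  assumes G: "pair_graph G"
    and nbr: "\<And>u. u \<in> pverts G \<Longrightarrow> \<exists>v. (u, v) \<in> parcs G"
    and diam: "\<And>u v. \<lbrakk>u \<in> pverts G; v \<in> pverts G; u \<noteq> v; (u, v) \<notin> parcs G\<rbrakk>
                 \<Longrightarrow> \<exists>m. (u, m) \<in> parcs G \<and> (m, v) \<in> parcs G"
    and "s \<in> pverts (mycielskian G)" "t \<in> pverts (mycielskian G)"
    and "s \<noteq> t" "(s, t) \<notin> parcs (mycielskian G)"
  shows "\<exists>m. (s, m) \<in> parcs (mycielskian G) \<and> (m, t) \<in> parcs (mycielskian G)"
proof -
  interpret pair_graph G by fact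
  have sym: "(b, a) \<in> parcs G" if "(a, b) \<in> parcs G" for a b
    using that arcs_symmetric by blast
  have walk: "\<exists>m. (u, m) \<in> parcs G \<and> (m, v) \<in> parcs G"
    if "u \<in> pverts G" "v \<in> pverts G" "(u, v) \<notin> parcs G" for u v
    using that nbr diam sym by (cases "u = v") blast+
  have to_root: "\<exists>v. (u, v) \<in> parcs G \<and> v \<in> pverts G" if "u \<in> pverts G" for u
    using nbr[OF that] in_arcsD2 by blast
  show ?thesis
  proof (cases s)
    case (Orig u)
    then show ?thesis
      using assms(4-7) walk[of u] to_root[of u] by (cases t) (auto; metis parcs_mycielskian_iff)+
  next
    case (Copy u)
    then show ?thesis
      using assms(4-7) walk[of u] by (cases t) (auto; metis parcs_mycielskian_iff)+
  next
    case Root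
    then show ?thesis
      using assms(4-7) to_root sym by (cases t) (auto; metis parcs_mycielskian_iff)+
  qed
qed

section \<open>General position sets containing the root\<close>

text \<open>
  The root is isolated in the graph induced on this set, the rest of which is a clique.
\<close>

lemma general_position_of_complete:
  assumes G: "pair_graph G" and n: "card (pverts G) \<ge> 2"
    and compl: "complete_digraph (card (pverts G)) (with_proj G)"
  shows "general_position (mycielskian G) (insert Root (Orig ` pverts G))"
proof (rule general_position_diameter_two[OF pair_graph_mycielskian[OF G]])
  have arcs: "(u, v) \<in> parcs G \<longleftrightarrow> u \<in> pverts G \<and> v \<in> pverts G \<and> u \<noteq> v" for u v
    using compl by (auto simp: complete_digraph_pair_def)
  have "\<exists>v. (u, v) \<in> parcs G" if "u \<in> pverts G" for u
  proof -
    have "\<not> pverts G \<subseteq> {u}"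
      using n card_mono[of "{u}" "pverts G"] by auto
    then show ?thesis using that arcs by blast
  qed
  then show "\<exists>m. (s, m) \<in> parcs (mycielskian G) \<and> (m, t) \<in> parcs (mycielskian G)"
    if "s \<in> pverts (mycielskian G)" "t \<in> pverts (mycielskian G)"
      "s \<noteq> t" "(s, t) \<notin> parcs (mycielskian G)" for s t
    using mycielskian_diameter_two[OF G] that arcs by blast
  show "(a, c) \<in> parcs (mycielskian G)"
    if "a \<in> insert Root (Orig ` pverts G)" "b \<in> insert Root (Orig ` pverts G)"
      "c \<in> insert Root (Orig ` pverts G)"
      "(a, b) \<in> parcs (mycielskian G)" "(b, c) \<in> parcs (mycielskian G)" "a \<noteq> c" for a b c
    using that arcs by auto
qed auto

text \<open>
  Within this set the copy of \<open>y\<close> is adjacent only to the root, as the only neighbour \<open>x\<close> of \<open>y\<close> has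
  been left out. The induced graph is thus the edge from the root to this copy together with
  the cliques of \<open>G - x\<close>, and has no induced path on three vertices.
\<close>

lemma general_position_of_cone:
  assumes G: "pair_graph G" and cone: "pendant_clique_cone G x y"
  shows "general_position (mycielskian G)
           ({Root, Copy y} \<union> Orig ` (pverts G - {x}))" (is "general_position _ ?S")
proof (rule general_position_diameter_two[OF pair_graph_mycielskian[OF G]])
  interpret pair_graph G by fact
  have sym: "(b, a) \<in> parcs G" if "(a, b) \<in> parcs G" for a b
    using that arcs_symmetric by blast
  have y: "x \<in> pverts G" "y \<in> pverts G - {x}"
    and univ: "\<And>v. v \<in> pverts G - {x} \<Longrightarrow> (x, v) \<in> parcs G"
    and leaf: "\<And>v. (y, v) \<in> parcs G \<Longrightarrow> v = x"
    and tr: "\<And>a b c. \<lbrakk>a \<noteq> x; b \<noteq> x; c \<noteq> x; a \<noteq> c; (a, b) \<in> parcs G; (b, c) \<in> parcs G\<rbrakk>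
               \<Longrightarrow> (a, c) \<in> parcs G"
    using cone unfolding pendant_clique_cone_def by blast+
  have leaf': "v = x" if "(v, y) \<in> parcs G" for v
    using that sym leaf by blast
  have nbr: "\<exists>v. (u, v) \<in> parcs G" if "u \<in> pverts G" for u
    using that y univ sym by (cases "u = x") blast+
  have diam: "\<exists>m. (u, m) \<in> parcs G \<and> (m, v) \<in> parcs G"
    if "u \<in> pverts G" "v \<in> pverts G" "u \<noteq> v" "(u, v) \<notin> parcs G" for u v
    using that univ[of u] univ[of v] sym by blast
  show "\<exists>m. (s, m) \<in> parcs (mycielskian G) \<and> (m, t) \<in> parcs (mycielskian G)"
    if "s \<in> pverts (mycielskian G)" "t \<in> pverts (mycielskian G)"
      "s \<noteq> t" "(s, t) \<notin> parcs (mycielskian G)" for s t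
    using mycielskian_diameter_two[OF G nbr diam that] by blast
  show "(a, c) \<in> parcs (mycielskian G)"
    if "a \<in> ?S" "b \<in> ?S" "c \<in> ?S"
      "(a, b) \<in> parcs (mycielskian G)" "(b, c) \<in> parcs (mycielskian G)" "a \<noteq> c" for a b c
    using that by (auto dest: leaf leaf' intro: tr)
  show "?S \<subseteq> pverts (mycielskian G)"
    using y by auto
qed

text \<open>
  The two outcomes correspond to \<open>S\<close> containing every original vertex, or missing exactly one of
  them, which becomes the apex of the cone.
\<close>

lemma general_position_root_cases:
  assumes G: "pair_graph G" and conn: "Digraph_Component.connected (with_proj G)"
    and n: "card (pverts G) \<ge> 2"
    and gp: "general_position (mycielskian G) S" and root: "Root \<in> S"
    and big: "card S \<ge> card (pverts G) + 1"
  shows "complete_digraph (card (pverts G)) (with_proj G) \<or> (\<exists>x y. pendant_clique_cone G x y)"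
proof -
  interpret pair_graph G by fact
  have sym: "(b, a) \<in> parcs G" if "(a, b) \<in> parcs G" for a b
    using that arcs_symmetric by blast
  define A where "A = {v. Orig v \<in> S}"
  define B where "B = {v. Copy v \<in> S}"
  have sub: "A \<subseteq> pverts G" "B \<subseteq> pverts G"
    using gp by (auto simp: general_position_def A_def B_def)
  have fin: "finite A" "finite B"
    using sub finite_subset pair_finite_verts by blast+
  have S: "S = insert Root (Orig ` A \<union> Copy ` B)"
  proof (intro equalityI subsetI)
    show "s \<in> insert Root (Orig ` A \<union> Copy ` B)" if "s \<in> S" for s
      using that by (cases s) (auto simp: A_def B_def)
  qed (use root in \<open>auto simp: A_def B_def\<close>)
  have "card (Orig ` A \<union> Copy ` B) = card A + card B"
    using fin by (subst card_Un_disjoint) (auto simp: card_image inj_on_def)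
  then have cardS: "card S = Suc (card A + card B)"
    using fin unfolding S by (subst card_insert_disjoint) auto
  have closed: "(a, c) \<in> parcs G" if "a \<in> A" "b \<in> A" "c \<in> A"
    "(a, b) \<in> parcs G" "(b, c) \<in> parcs G" "a \<noteq> c" for a b c
    using general_position_adjacent_closed[OF gp, of "Orig a" "Orig b" "Orig c"] that no_loops'
    by (auto simp: A_def)
  \<comment> \<open>The geodesic \<open>u', u\<^sup>*, v'\<close>.\<close>
  have B1: "u = v" if "u \<in> B" "v \<in> B" for u v
    using general_position_adjacent_closed[OF gp, of "Copy u" Root "Copy v"] that sub root
    by (auto simp: B_def)
  \<comment> \<open>The geodesic \<open>u, v', u\<^sup>*\<close>.\<close>
  have sep: "(u, v) \<notin> parcs G" if "u \<in> A" "v \<in> B" for u v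
    using general_position_adjacent_closed[OF gp, of "Orig u" "Copy v" Root] that sub root
    by (auto simp: A_def B_def)
  show ?thesis
  proof (cases "A = pverts G")
    case True
    have "complete_digraph (card (pverts G)) (with_proj G)"
      by (rule connected_adjacent_closed_imp_complete[OF G conn])
        (use True closed in_arcsD1 in_arcsD2 in blast)
    then show ?thesis ..
  next
    case False
    have "card B \<le> 1"
      using B1 fin by (simp add: card_le_Suc0_iff_eq)
    moreover have "card A < card (pverts G)"
      using False sub by (intro psubset_card_mono) auto
    ultimately have "card (pverts G - A) = 1" "card B = 1"
      using big cardS sub fin by (auto simp: card_Diff_subset)
    then obtain x y where x: "pverts G - A = {x}" and B: "B = {y}"
      by (auto simp: card_1_singleton_iff)
    have A: "A = pverts G - {x}" and xV: "x \<in> pverts G"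
      using x sub by auto
    have leaf: "v = x" if "(y, v) \<in> parcs G" for v
      using that sep[of v y] sym B A in_arcsD2 by blast
    obtain w where "(y, w) \<in> parcs G"
      using connected_ex_neighbour[OF G conn n] B sub by auto
    then have yx: "(y, x) \<in> parcs G"
      using leaf by blast
    have "pverts G \<subseteq> insert x {v. (x, v) \<in> parcs G}"
    proof (rule connected_closed_set_eq_verts[OF G conn, of x])
      fix a b assume a: "a \<in> insert x {v. (x, v) \<in> parcs G}" and ab: "(a, b) \<in> parcs G"
      show "b \<in> insert x {v. (x, v) \<in> parcs G}"
      proof (rule ccontr)
        assume b: "b \<notin> insert x {v. (x, v) \<in> parcs G}"
        have "a \<noteq> x" "b \<noteq> y" "a \<noteq> y" "a \<noteq> b"
          using b ab yx sym leaf no_loops' by blast+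
        \<comment> \<open>The path \<open>y', x, a, b\<close> cannot be a geodesic. But a shortcut from \<open>y'\<close> to \<open>b\<close> would
          have to avoid the root, which has no original neighbour, and so would show that
          \<open>b = x\<close> or that \<open>x\<close> is adjacent to \<open>b\<close>.\<close>
        then have "(Copy y, Orig b) \<in> parcs (mycielskian G) \<or>
            (\<exists>m. (Copy y, m) \<in> parcs (mycielskian G) \<and> (m, Orig b) \<in> parcs (mycielskian G))"
          using a b ab yx B A in_arcsD1 in_arcsD2
          by (intro general_position_three_step_shortcut[OF gp, of _ "Orig a" _ "Orig x"])
            (auto simp: A_def B_def)
        then obtain m where "(Copy y, m) \<in> parcs (mycielskian G)"
          "(m, Orig b) \<in> parcs (mycielskian G)"
          using leaf b by auto
        then show False
          using leaf b by (cases m) auto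
      qed
    qed (use xV in auto)
    moreover have "y \<noteq> x"
      using yx no_loops' by blast
    moreover have "(a, c) \<in> parcs G"
      if "a \<noteq> x" "b \<noteq> x" "c \<noteq> x" "a \<noteq> c" "(a, b) \<in> parcs G" "(b, c) \<in> parcs G" for a b c
      using closed[of a b c] that in_arcsD1[of a b] in_arcsD1[of b c] in_arcsD2[of b c]
      unfolding A by simp
    moreover have "y \<in> pverts G"
      using B sub by simp
    ultimately have "pendant_clique_cone G x y"
      unfolding pendant_clique_cone_def using xV leaf by blast
    then show ?thesis by blast
  qed
qed

theorem lemma1:
  fixes G :: "'a pair_pre_digraph" and n :: nat
  assumes "pair_graph G"
    and "Digraph_Component.connected (with_proj G)"
    and "card (pverts G) = n"
    and "n \<ge> 3"
  shows "(\<exists>S. general_position (mycielskian G) S \<and> card S \<ge> n + 1 \<and> Root \<in> S) \<longleftrightarrow>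
    complete_digraph n (with_proj G) \<or>
    (\<exists>K H Cs. complete_digraph 1 (with_proj K) \<and>
       is_join G K H \<and> is_disjoint_union H Cs \<and>
       (\<forall>C\<in>Cs. \<exists>m\<ge>1. complete_digraph m (with_proj C)) \<and>
       (\<exists>C\<in>Cs. complete_digraph 1 (with_proj C)))" (is "?L \<longleftrightarrow> ?C \<or> ?J")
proof -
  interpret pair_graph G by fact
  have n2: "card (pverts G) \<ge> 2" using assms(3,4) by simp
  have cone: "?J \<longleftrightarrow> (\<exists>x y. pendant_clique_cone G x y)"
  proof
    assume ?J
    then show "\<exists>x y. pendant_clique_cone G x y"
      by (elim exE bexE conjE) (rule pendant_clique_cone_of_join; blast)
  next
    assume "\<exists>x y. pendant_clique_cone G x y"
    then show ?J
      by (elim exE) (rule join_of_pendant_clique_cone[OF assms(1)])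
  qed
  have "?L" if "?C"
  proof (intro exI conjI)
    let ?S = "insert Root (Orig ` pverts G)"
    show "general_position (mycielskian G) ?S"
      using general_position_of_complete assms(1,3) n2 that by blast
    show "n + 1 \<le> card ?S"
      using assms(3) by (subst card_insert_disjoint) (auto simp: card_image inj_on_def)
  qed simp
  moreover have "?L" if "pendant_clique_cone G x y" for x y
  proof (intro exI conjI)
    let ?S = "{Root, Copy y} \<union> Orig ` (pverts G - {x})"
    show "general_position (mycielskian G) ?S"
      by (rule general_position_of_cone[OF assms(1) that])
    have "x \<in> pverts G" using that unfolding pendant_clique_cone_def by blast
    then have "card (Orig ` (pverts G - {x})) = n - 1"
      using assms(3) by (simp add: card_image inj_on_def)
    moreover have "card ?S = card {Root, Copy y} + card (Orig ` (pverts G - {x}))"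
      by (rule card_Un_disjoint) auto
    ultimately show "n + 1 \<le> card ?S" using assms(4) by simp
  qed simp
  moreover have "?C \<or> (\<exists>x y. pendant_clique_cone G x y)" if "?L"
    using that general_position_root_cases[OF assms(1,2) n2] assms(3) by auto
  ultimately show ?thesis
    unfolding cone by blast
qed

end
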